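(* Let $B=(\beta_1,\dots,\beta_p)$ be an alternate base with period $p$, and let $\mathbf{t}^{(\ell)}=t_1^{(\ell)}t_2^{(\ell)}t_3^{(\ell)}\cdots=d_{B^{(\ell)}}(1)$ be the corresponding expansions of $1$. Suppose that $$t_1^{(\ell)}\ \ge\ t_2^{(\ell-1)}\ \ge\ t_3^{(\ell-2)}\ \ge\ \cdots\qquad\text{for every }\ell\in\{1,\dots,p\},$$ where upper indices are taken modulo $p$ with representatives in $\{1,\dots,p\}$. Then $B$ is a Parry alternate base and has Property (PF). If, moreover, $B$ is a simple Parry alternate base, then it satisfies Property (F).
   Context: An alternate base with period $p\ge 1$, written $B=(\beta_1,\dots,\beta_p)$, is a purely periodic sequence $(\beta_n)_{n\ge1}$ of real numbers $\beta_n>1$ with $\beta_{n+p}=\beta_n$ for all $n$. For $k\ge1$, $B^{(k)}=(\beta_n)_{n\ge k}$ is the shifted base, so $B^{(k+p)}=B^{(k)}$. Greedy expansion: for $x\in[0,1]$ put $x_1=\lfloor\beta_1x\rfloor$, $r_1=\beta_1x-x_1$, and for $n\ge2$ put $x_n=\lfloor\beta_nr_{n-1}\rfloor$, $r_n=\beta_nr_{n-1}-x_n$; the sequence $d_B(x)=x_1x_2x_3\cdots$ is the $B$-expansion of $x$. In particular this defines $d_B(1)$. The expansion $d_{B^{(k)}}$ is defined in the same way using the base sequence $B^{(k)}$. $\mathcal{F}$ is the set of sequences $(x_n)_{n\ge1}$ of non-negative integers with only finitely many nonzero terms, and $\mathrm{Fin}(B)=\{x\in[0,1): d_B(x)\in\mathcal{F}\}$.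 Property (PF): for all $x,y\in\mathrm{Fin}(B)$, $x+y\in[0,1)$ implies $x+y\in\mathrm{Fin}(B)$. Property (F): for all $x,y\in\mathrm{Fin}(B)$, $x+y\in[0,1)$ implies $x+y\in\mathrm{Fin}(B)$, and $x-y\in[0,1)$ implies $x-y\in\mathrm{Fin}(B)$. $B$ is a Parry alternate base if all the sequences $\mathbf{t}^{(\ell)}$, $\ell\in\{1,\dots,p\}$, are eventually periodic; it is a simple Parry alternate base if moreover $\mathbf{t}^{(\ell)}\in\mathcal{F}$ for every $\ell\in\{1,\dots,p\}$. *)

theory Defs
  imports Complex_Main
begin

text \<open>
  All sequences are indexed from 1; the value at index 0 is irrelevant
  and never used.  The period \<open>p\<close> is not required to be minimal.
\<close>

definition alternate_base :: "nat \<Rightarrow> (nat \<Rightarrow> real) \<Rightarrow> bool" where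
  "alternate_base p \<beta> \<longleftrightarrow> p \<ge> 1 \<and> (\<forall>n\<ge>1. \<beta> n > 1 \<and> \<beta> (n + p) = \<beta> n)"

text \<open>\<open>B\<^sup>(\<^sup>k\<^sup>) = (\<beta>\<^sub>n)\<^sub>n\<^sub>\<ge>\<^sub>k\<close>, reindexed from 1: the first entry is \<open>\<beta> k\<close>. Meant for \<open>k \<ge> 1\<close>.\<close>
definition base_shift :: "nat \<Rightarrow> (nat \<Rightarrow> real) \<Rightarrow> nat \<Rightarrow> real" where
  "base_shift k \<beta> n = \<beta> (n + k - 1)"

text \<open>The remainders \<open>r\<^sub>n\<close>, with the convention \<open>r\<^sub>0 = x\<close>.\<close>
primrec greedy_remainder :: "(nat \<Rightarrow> real) \<Rightarrow> real \<Rightarrow> nat \<Rightarrow> real" where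
  "greedy_remainder \<beta> x 0 = x"
| "greedy_remainder \<beta> x (Suc n) =
     \<beta> (Suc n) * greedy_remainder \<beta> x n - of_int \<lfloor>\<beta> (Suc n) * greedy_remainder \<beta> x n\<rfloor>"

text \<open>\<open>d\<^sub>B(x)\<close>; meant for \<open>x \<in> [0,1]\<close> and read at indices \<open>n \<ge> 1\<close>.\<close>
definition greedy_expansion :: "(nat \<Rightarrow> real) \<Rightarrow> real \<Rightarrow> nat \<Rightarrow> int" where
  "greedy_expansion \<beta> x n = \<lfloor>\<beta> n * greedy_remainder \<beta> x (n - 1)\<rfloor>"

text \<open>\<open>t\<^sup>(\<^sup>l\<^sup>) = d(1) with respect to the shifted base B\<^sup>(\<^sup>l\<^sup>)\<close>.\<close>
definition expansion_of_one :: "(nat \<Rightarrow> real) \<Rightarrow> nat \<Rightarrow> nat \<Rightarrow> int" where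
  "expansion_of_one \<beta> l = greedy_expansion (base_shift l \<beta>) 1"

definition finite_sequences :: "(nat \<Rightarrow> int) set" where
  "finite_sequences = {a. (\<forall>n\<ge>1. a n \<ge> 0) \<and> finite {n. n \<ge> 1 \<and> a n \<noteq> 0}}"

definition Fin :: "(nat \<Rightarrow> real) \<Rightarrow> real set" where
  "Fin \<beta> = {x \<in> {0..<1}. greedy_expansion \<beta> x \<in> finite_sequences}"

definition property_PF :: "(nat \<Rightarrow> real) \<Rightarrow> bool" where
  "property_PF \<beta> \<longleftrightarrow>
     (\<forall>x\<in>Fin \<beta>. \<forall>y\<in>Fin \<beta>. x + y \<in> {0..<1} \<longrightarrow> x + y \<in> Fin \<beta>)"

definition property_F :: "(nat \<Rightarrow> real) \<Rightarrow> bool" where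
  "property_F \<beta> \<longleftrightarrow>
     (\<forall>x\<in>Fin \<beta>. \<forall>y\<in>Fin \<beta>.
        (x + y \<in> {0..<1} \<longrightarrow> x + y \<in> Fin \<beta>) \<and>
        (x - y \<in> {0..<1} \<longrightarrow> x - y \<in> Fin \<beta>))"

definition eventually_periodic :: "(nat \<Rightarrow> int) \<Rightarrow> bool" where
  "eventually_periodic a \<longleftrightarrow> (\<exists>N\<ge>1. \<exists>q\<ge>1. \<forall>n\<ge>N. a (n + q) = a n)"

definition parry_alternate_base :: "nat \<Rightarrow> (nat \<Rightarrow> real) \<Rightarrow> bool" where
  "parry_alternate_base p \<beta> \<longleftrightarrow>
     alternate_base p \<beta> \<and> (\<forall>l\<in>{1..p}. eventually_periodic (expansion_of_one \<beta> l))"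

definition simple_parry_alternate_base :: "nat \<Rightarrow> (nat \<Rightarrow> real) \<Rightarrow> bool" where
  "simple_parry_alternate_base p \<beta> \<longleftrightarrow>
     parry_alternate_base p \<beta> \<and> (\<forall>l\<in>{1..p}. expansion_of_one \<beta> l \<in> finite_sequences)"

text \<open>The representative in \<open>{1, \<dots>, p}\<close> of the residue class of \<open>i\<close> modulo \<open>p\<close>.\<close>
definition cyclic_index :: "nat \<Rightarrow> int \<Rightarrow> nat" where
  "cyclic_index p i = nat ((i - 1) mod int p) + 1"

end

theory Submission
  imports Defs "HOL-Library.Multiset"
begin

text \<open>
  Why the theorem holds.  Write \<open>d l j\<close> for the digit \<open>t\<^sub>j\<^sub>+\<^sub>1\<close> of the expansion of 1 that starts
  at position \<open>l\<close>; it sits at position \<open>l + j\<close>.  The hypothesis says that, at a given position,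
  an expansion that starts later has the larger digit: \<open>d (l + 1) j \<ge> d l (j + 1)\<close>.  A nonincreasing
  sequence of natural numbers is eventually constant, so from some index \<open>J\<close> on the digit depends
  on its position alone, \<open>d l j = c (l + j)\<close>, with \<open>c\<close> periodic.  This is the Parry property.

  For Property (PF), a number with a finite expansion is the value of a finite string of
  nonnegative digits, and such strings are closed under addition.  It remains to bring every finite
  string to greedy form without leaving the finite strings.  If a string is too large at some place,
  then either its tail is a finite expansion of 1, to be replaced by a unit one position earlier, or
  it contains an overflow: \<open>d l 0, ..., d l (n - 1), d l n + 1\<close> at the positions \<open>l, ..., l + n\<close>.
  Expanding the spare unit at position \<open>l + n\<close> and comparing with the rest of the expansion that starts
  at \<open>l\<close>, the overflow has the same value as one unit at position \<open>l - 1\<close> followed by the digits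
  \<open>d (l + n + 1) j - d l (n + 1 + j)\<close>.  These are nonnegative by hypothesis, and they vanish for
  \<open>j \<ge> J\<close>, so the new string is again finite and nonnegative.

  What must be shown is that carrying terminates, since every carry may create digits further to
  the right.  For \<open>p = 1\<close> the digit sum does not increase.  In general one needs a weighted digit
  sum, with a \<open>p\<close>-periodic positive weight \<open>w\<close>.  The change of weight is governed by the
  numbers \<open>h l = (\<Sum>j<J. (d l j - c (l + j)) * w (l + j)) - w (l - 1)\<close>, and weights do not
  increase when \<open>h\<close> is constant; if a whole finite expansion of 1 is carried, the constant must also
  be nonnegative, which then follows because all expansions have first digit at least 1.
  The equation \<open>h (l + 1) = h l\<close> turns out to be the balance equation, at state \<open>l\<close>, of a Markov chain on the residues modulo \<open>p\<close>: it moves from \<open>m\<close> to \<open>m + 1\<close>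
  at rate 1 and from \<open>m\<close> to \<open>m - k\<close> at rate \<open>d (m + 1 - k) (k - 1) - d (m - k) k \<ge> 0\<close>.  A stationary
  vector exists, and it is positive because the forward steps connect all states
  (\<open>stationary_vector_exists\<close>, \<open>balancing_weights_exist\<close>, \<open>weight_carried\<close>).  Bounded weight
  then gives termination (\<open>normal_form_exists\<close>).

  For Property (F) it suffices to subtract a single unit at position \<open>k\<close> from a string of at least
  that value.  Its normal form has a unit at some position \<open>i \<le> k\<close>, for otherwise its value
  would be too small.  If all expansions of 1 are finite, that unit can be expanded repeatedly, at
  each step into a finite string with a nonzero leading digit, until a unit at position \<open>k\<close> appears.
\<close>

section \<open>Stationary vectors of finite flows\<close>

text \<open>
  A stationary measure of a continuous-time Markov chain with rates \<open>q\<close>, obtained by state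
  elimination.  Either the state \<open>s\<close> is absorbing, and the point mass at \<open>s\<close> is stationary, or the
  chain watched only outside \<open>s\<close> is again a chain; a stationary vector of it extends to \<open>s\<close> by the
  balance equation at \<open>s\<close>.
\<close>

lemma stationary_vector_exists:
  fixes q :: "'a \<Rightarrow> 'a \<Rightarrow> real"
  assumes "finite A" "A \<noteq> {}" and nonneg: "\<And>i j. i \<in> A \<Longrightarrow> j \<in> A \<Longrightarrow> q i j \<ge> 0"
  shows "\<exists>w. (\<forall>i\<in>A. w i \<ge> 0) \<and> (\<exists>i\<in>A. w i > 0)
           \<and> (\<forall>i\<in>A. w i * (\<Sum>j\<in>A. q i j) = (\<Sum>j\<in>A. w j * q j i))"
  using assms
proof (induction A arbitrary: q rule: finite_ne_induct)
  case (singleton s)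
  show ?case by (rule exI[of _ "\<lambda>_. 1"]) auto
next
  case (insert s A)
  define Q where "Q = (\<Sum>j\<in>A. q s j)"
  have Q_nonneg: "Q \<ge> 0" unfolding Q_def using insert.prems by (intro sum_nonneg) auto
  show ?case
  proof (cases "Q = 0")
    case True
    then have "\<forall>j\<in>A. q s j = 0"
      unfolding Q_def using insert.hyps insert.prems by (subst (asm) sum_nonneg_eq_0_iff) auto
    then show ?thesis
      using insert.hyps True
      by (intro exI[of _ "\<lambda>i. if i = s then 1 else 0"])
         (auto simp: Q_def if_distrib[of "\<lambda>x. x * _"] cong: if_cong)
  next
    case False
    then have Q: "Q > 0" using Q_nonneg by simp
    \<comment> \<open>a detour through \<open>s\<close> counts as a direct transition\<close>
    define q' where "q' i j = q i j + q i s * q s j / Q" for i j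
    have "q' i j \<ge> 0" if "i \<in> A" "j \<in> A" for i j
      unfolding q'_def using that insert.prems Q by (intro add_nonneg_nonneg) auto
    then obtain w where
      w0: "\<forall>i\<in>A. w i \<ge> 0" and w1: "\<exists>i\<in>A. w i > 0"
      and bal: "\<forall>i\<in>A. w i * (\<Sum>j\<in>A. q' i j) = (\<Sum>j\<in>A. w j * q' j i)"
      using insert.IH[of q'] by blast
    define v where "v = (\<Sum>j\<in>A. w j * q j s) / Q"
    have v: "v \<ge> 0" unfolding v_def using w0 insert.prems Q
      by (intro divide_nonneg_nonneg sum_nonneg mult_nonneg_nonneg) auto
    have out: "(\<Sum>j\<in>A. q' i j) = (\<Sum>j\<in>A. q i j) + q i s" for i
      using Q by (simp add: q'_def sum.distrib sum_distrib_left[symmetric]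
          sum_divide_distrib[symmetric] Q_def[symmetric])
    have "(\<Sum>j\<in>A. w j * q' j i) = (\<Sum>j\<in>A. w j * q j i) + v * q s i" for i
    proof -
      have "w j * q' j i = w j * q j i + w j * q j s * (q s i / Q)" for j
        by (simp add: q'_def algebra_simps)
      then show ?thesis
        by (simp add: v_def sum.distrib sum_distrib_right sum_divide_distrib)
    qed
    then have at_A: "\<forall>i\<in>A. w i * (\<Sum>j\<in>insert s A. q i j) = (\<Sum>j\<in>A. w j * q j i) + v * q s i"
      using bal out insert.hyps by (simp add: add.commute)
    have at_s: "v * Q = (\<Sum>j\<in>A. w j * q j s)" using Q by (simp add: v_def)
    have ne: "j \<noteq> s" if "j \<in> A" for j using that insert.hyps by auto
    have sums: "(\<Sum>j\<in>insert s A. (if j = s then v else w j) * q j i) = v * q s i + (\<Sum>j\<in>A. w j * q j i)" for i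
      using insert.hyps ne by (simp add: sum.insert cong: sum.cong)
    show ?thesis
      using w0 w1 v at_A at_s ne insert.hyps
      by (intro exI[of _ "\<lambda>i. if i = s then v else w i"] conjI)
         (auto simp: sums Q_def[symmetric] algebra_simps simp del: sum.insert, auto simp: Q_def algebra_simps)
  qed
qed

lemma periodic_mod:
  fixes f :: "nat \<Rightarrow> 'a"
  assumes "\<And>l. f (l + p) = f l"
  shows "f (l mod p) = f l"
proof -
  have "f (m + k * p) = f m" for m k
    by (induction k) (simp_all add: assms[of "m + _ * p"] add.commute add.left_commute, metis assms add.assoc add.commute)
  from this[of "l mod p" "l div p"] show ?thesis by simp
qed

text \<open>
  The same for a chain on the residues modulo \<open>p\<close>, written with periodic functions on the natural
  numbers.  The flow of kind \<open>\<kappa>\<close> into state \<open>l\<close> has rate \<open>r \<kappa> l\<close> and comes from \<open>l + s \<kappa>\<close>.  The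
  flow of kind \<open>\<kappa>\<close> out of \<open>l\<close> goes to \<open>l - s \<kappa>\<close>, which is congruent to \<open>l + (p - 1) * s \<kappa>\<close> and so
  can be written without subtraction.
\<close>
lemma cyclic_stationary_vector_exists:
  fixes r :: "'k \<Rightarrow> nat \<Rightarrow> real" and s :: "'k \<Rightarrow> nat"
  assumes p: "p \<ge> 1" and "finite K"
    and nonneg: "\<And>\<kappa> l. r \<kappa> l \<ge> 0" and periodic: "\<And>\<kappa> l. r \<kappa> (l + p) = r \<kappa> l"
  shows "\<exists>w. (\<forall>l. w l \<ge> 0 \<and> w (l + p) = w l) \<and> (\<exists>l. w l > 0) \<and>
    (\<forall>l. (\<Sum>\<kappa>\<in>K. r \<kappa> l * w (l + s \<kappa>)) = w l * (\<Sum>\<kappa>\<in>K. r \<kappa> (l + (p - 1) * s \<kappa>)))"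
proof -
  define q where "q i j = (\<Sum>\<kappa>\<in>K. if (j + s \<kappa>) mod p = i then r \<kappa> j else 0)" for i j
  have "q i j \<ge> 0" for i j unfolding q_def by (intro sum_nonneg) (auto simp: nonneg)
  then obtain w where w0: "\<forall>i\<in>{..<p}. w i \<ge> 0" and w1: "\<exists>i\<in>{..<p}. w i > 0"
    and bal: "\<forall>i\<in>{..<p}. w i * (\<Sum>j<p. q i j) = (\<Sum>j<p. w j * q j i)"
    using stationary_vector_exists[of "{..<p}" q] p by (auto simp: lessThan_empty_iff)
  have r_mod: "r \<kappa> (l mod p) = r \<kappa> l" for \<kappa> l
    using periodic_mod[of "r \<kappa>" p l] periodic by simp
  have inv: "(j + s) mod p = i \<longleftrightarrow> j = (i + (p - 1) * s) mod p" if "i < p" "j < p" for i j s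
  proof
    have *: "s + (p - 1) * s = p * s" using p by (cases p) auto
    { assume "(j + s) mod p = i"
      then have "(i + (p - 1) * s) mod p = (j + s + (p - 1) * s) mod p"
        by (metis mod_add_left_eq)
      also have "\<dots> = j" using * that by (simp add: add.assoc)
      finally show "j = (i + (p - 1) * s) mod p" by simp }
    { assume "j = (i + (p - 1) * s) mod p"
      then have "(j + s) mod p = (i + (p - 1) * s + s) mod p"
        by (metis mod_add_left_eq)
      also have "\<dots> = i" using * that by (simp add: add.assoc add.commute[of "(p - 1) * s" s] del: One_nat_def)
      finally show "(j + s) mod p = i" . }
  qed
  have out: "(\<Sum>j<p. q i j) = (\<Sum>\<kappa>\<in>K. r \<kappa> (i + (p - 1) * s \<kappa>))" if "i < p" for i
  proof -
    have "(\<Sum>j<p. q i j) = (\<Sum>\<kappa>\<in>K. \<Sum>j<p. if (j + s \<kappa>) mod p = i then r \<kappa> j else 0)"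
      unfolding q_def by (rule sum.swap)
    also have "\<dots> = (\<Sum>\<kappa>\<in>K. \<Sum>j<p. if j = (i + (p - 1) * s \<kappa>) mod p then r \<kappa> j else 0)"
      using inv that by (intro sum.cong refl) auto
    also have "\<dots> = (\<Sum>\<kappa>\<in>K. r \<kappa> (i + (p - 1) * s \<kappa>))"
      using p by (intro sum.cong refl) (simp add: r_mod)
    finally show ?thesis .
  qed
  have into: "(\<Sum>j<p. w j * q j i) = (\<Sum>\<kappa>\<in>K. r \<kappa> i * w ((i + s \<kappa>) mod p))" for i
  proof -
    have "(\<Sum>j<p. w j * q j i) = (\<Sum>j<p. \<Sum>\<kappa>\<in>K. if (i + s \<kappa>) mod p = j then w j * r \<kappa> i else 0)"
      unfolding q_def sum_distrib_left by (intro sum.cong refl) auto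
    also have "\<dots> = (\<Sum>\<kappa>\<in>K. \<Sum>j<p. if (i + s \<kappa>) mod p = j then w j * r \<kappa> i else 0)"
      by (rule sum.swap)
    also have "\<dots> = (\<Sum>\<kappa>\<in>K. r \<kappa> i * w ((i + s \<kappa>) mod p))"
      using p by (intro sum.cong refl) (simp add: mult.commute)
    finally show ?thesis .
  qed
  have "(\<Sum>\<kappa>\<in>K. r \<kappa> l * w ((l + s \<kappa>) mod p)) = w (l mod p) * (\<Sum>\<kappa>\<in>K. r \<kappa> (l + (p - 1) * s \<kappa>))" for l
  proof -
    have lt: "l mod p < p" using p by simp
    have "r \<kappa> (l mod p + x) = r \<kappa> (l + x)" for \<kappa> x
      by (metis r_mod mod_add_left_eq)
    then show ?thesis
      using bal[rule_format, of "l mod p"] out[OF lt] into[of "l mod p"] lt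
      by (simp add: r_mod mod_add_left_eq)
  qed
  then show ?thesis
    using w0 w1 p by (intro exI[of _ "\<lambda>l. w (l mod p)"]) (auto, metis mod_less)
qed

section \<open>Bounded orbits of an expanding map\<close>

lemma bounded_expanding_orbit_zero:
  fixes y :: "nat \<Rightarrow> real"
  assumes step: "\<And>n. y (Suc n) = g n * y n" and g: "\<And>n. g n \<ge> b" and "b > 1"
    and bound: "\<And>n. \<bar>y n\<bar> \<le> C"
  shows "y 0 = 0"
proof (rule ccontr)
  assume y0: "y 0 \<noteq> 0"
  have grow: "b ^ n * \<bar>y 0\<bar> \<le> \<bar>y n\<bar>" for n
  proof (induction n)
    case (Suc n)
    have "b ^ Suc n * \<bar>y 0\<bar> \<le> b * \<bar>y n\<bar>" using Suc \<open>b > 1\<close> by (simp add: mult.assoc)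
    also have "\<dots> \<le> \<bar>g n\<bar> * \<bar>y n\<bar>" using g[of n] \<open>b > 1\<close> by (intro mult_right_mono) auto
    finally show ?case by (simp add: step abs_mult)
  qed simp
  obtain n where "C / \<bar>y 0\<bar> < b ^ n" using real_arch_pow[OF \<open>b > 1\<close>] by blast
  then have "C < b ^ n * \<bar>y 0\<bar>" using y0 by (simp add: field_simps)
  with grow[of n] bound[of n] show False by linarith
qed

lemma sum_split_tail:
  "(\<Sum>j<n + k. g (l + j) j) = (\<Sum>j<n. g (l + j) j) + (\<Sum>j<k. g (l + n + j) (n + j) :: real)"
  for g :: "nat \<Rightarrow> nat \<Rightarrow> real"
  by (induction k) (simp_all add: add.assoc)

section \<open>Digit strings as multisets of positions\<close>

text \<open>
  A finite string of nonnegative digits is represented by the multiset of its positions: the digit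
  at position \<open>i\<close> is the multiplicity of \<open>i\<close>.  Adding strings digit by digit is then the union of
  multisets, and values and weights of strings are additive functionals \<open>msum f\<close>.
\<close>
definition msum :: "(nat \<Rightarrow> real) \<Rightarrow> nat multiset \<Rightarrow> real" where
  "msum f M = (\<Sum>i\<in>#M. f i)"

lemma msum_simps [simp]:
  "msum f {#} = 0" "msum f {#i#} = f i" "msum f (M + N) = msum f M + msum f N"
  "msum f (add_mset i M) = f i + msum f M"
  by (simp_all add: msum_def)

lemma msum_replicate [simp]: "msum f (replicate_mset n i) = real n * f i"
  by (induction n) (simp_all add: algebra_simps)

lemma msum_diff: "N \<subseteq># M \<Longrightarrow> msum f (M - N) = msum f M - msum f N"
  by (metis add_diff_cancel_right' subset_mset.diff_add msum_simps(3))

lemma msum_nonneg: "(\<And>i. f i \<ge> 0) \<Longrightarrow> msum f M \<ge> 0"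
  by (induction M) (simp_all add: add_nonneg_nonneg)

lemma msum_mono: "(\<And>i. f i \<ge> 0) \<Longrightarrow> N \<subseteq># M \<Longrightarrow> msum f N \<le> msum f M"
  using msum_diff[of N M f] msum_nonneg[of f "M - N"] by simp

primrec digit_block :: "nat \<Rightarrow> (nat \<Rightarrow> int) \<Rightarrow> nat \<Rightarrow> nat multiset" where
  "digit_block l a 0 = {#}"
| "digit_block l a (Suc n) = digit_block l a n + replicate_mset (nat (a n)) (l + n)"

lemma msum_digit_block:
  "(\<And>j. j < n \<Longrightarrow> a j \<ge> 0) \<Longrightarrow> msum f (digit_block l a n) = (\<Sum>j<n. of_int (a j) * f (l + j))"
  by (induction n) simp_all

lemma count_digit_block:
  "count (digit_block l a n) i = (if l \<le> i \<and> i < l + n then nat (a (i - l)) else 0)"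
  by (induction n) auto

lemma digit_block_subset:
  "(\<And>j. j < n \<Longrightarrow> a j \<le> int (count M (l + j))) \<Longrightarrow> digit_block l a n \<subseteq># M"
proof (rule mset_subset_eqI)
  fix i assume "\<And>j. j < n \<Longrightarrow> a j \<le> int (count M (l + j))"
  from this[of "i - l"] show "count (digit_block l a n) i \<le> count M i"
    by (auto simp: count_digit_block nat_le_iff)
qed


section \<open>Expansions of one in an alternate base\<close>

locale alternate =
  fixes p :: nat and \<beta> :: "nat \<Rightarrow> real"
  assumes alternate: "alternate_base p \<beta>"
begin

text \<open>Indices start at 0, so that \<open>digit l j\<close> stands at position \<open>l + j\<close> of the base.\<close>
definition digit :: "nat \<Rightarrow> nat \<Rightarrow> int" where
  "digit l j = expansion_of_one \<beta> l (Suc j)"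

definition remainder :: "nat \<Rightarrow> nat \<Rightarrow> real" where
  "remainder l j = greedy_remainder (base_shift l \<beta>) 1 j"

text \<open>The value of one unit at position \<open>n\<close>; position 0 carries the integer part.\<close>
definition unit :: "nat \<Rightarrow> real" where
  "unit n = inverse (\<Prod>i=1..n. \<beta> i)"

abbreviation "value \<equiv> msum unit"

text \<open>The part of a string below position \<open>n\<close>, that is, to the right of it.\<close>
abbreviation below :: "nat multiset \<Rightarrow> nat \<Rightarrow> nat multiset" where
  "below M n \<equiv> {#i \<in># M. i > n#}"

text \<open>
  The greedy condition: what stands to the right of position \<open>n\<close> is worth less than one unit at
  \<open>n\<close>.  The digit at position 0 is not constrained.
\<close>
definition normal :: "nat multiset \<Rightarrow> bool" where
  "normal M \<longleftrightarrow> (\<forall>n. value (below M n) < unit n)"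

lemma p_pos: "p \<ge> 1" and beta_gt1: "n \<ge> 1 \<Longrightarrow> \<beta> n > 1"
  and beta_periodic: "n \<ge> 1 \<Longrightarrow> \<beta> (n + p) = \<beta> n"
  using alternate by (auto simp: alternate_base_def)

lemma beta_bounded_away: "\<exists>b>1. \<forall>n\<ge>1. b \<le> \<beta> n"
proof -
  let ?b = "Min (\<beta> ` {1..p})"
  have "?b > 1" using p_pos beta_gt1 by (subst Min_gr_iff) auto
  moreover have "?b \<le> \<beta> n" if "n \<ge> 1" for n
  proof -
    have "\<beta> n = \<beta> (Suc ((n - 1) mod p))"
    proof -
      have "\<beta> (Suc (m + p)) = \<beta> (Suc m)" for m using beta_periodic[of "Suc m"] by simp
      then have "\<beta> (Suc ((n - 1) mod p)) = \<beta> (Suc (n - 1))"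
        by (rule periodic_mod[of "\<lambda>m. \<beta> (Suc m)"])
      then show ?thesis using that by simp
    qed
    moreover have "Suc ((n - 1) mod p) \<in> {1..p}" using p_pos by (simp add: Suc_leI)
    ultimately show ?thesis by simp
  qed
  ultimately show ?thesis by blast
qed

lemma unit_0 [simp]: "unit 0 = 1" by (simp add: unit_def)

lemma unit_pos: "unit n > 0"
  unfolding unit_def using beta_gt1 by (intro positive_imp_inverse_positive prod_pos) (auto intro: less_trans[of 0 1])

lemma unit_rec: "unit n = \<beta> (Suc n) * unit (Suc n)"
  using beta_gt1[of "Suc n"] by (simp add: unit_def)

lemma unit_decreasing: "m \<le> n \<Longrightarrow> unit n \<le> unit m"
proof (rule lift_Suc_antimono_le[of unit])
  fix n show "unit (Suc n) \<le> unit n"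
    using unit_pos[of "Suc n"] beta_gt1[of "Suc n"] by (subst (2) unit_rec) simp
qed

lemma value_nonneg: "value M \<ge> 0" using msum_nonneg unit_pos less_imp_le by metis

lemma remainder_0 [simp]: "remainder l 0 = 1" by (simp add: remainder_def)

lemma remainder_Suc: "\<beta> (l + j) * remainder l j = of_int (digit l j) + remainder l (Suc j)"
  by (simp add: remainder_def digit_def expansion_of_one_def greedy_expansion_def base_shift_def add.commute)

lemma remainder_Suc_range: "0 \<le> remainder l (Suc j)" "remainder l (Suc j) < 1"
  using frac_ge_0 frac_lt_1 by (simp_all add: remainder_def frac_def[symmetric])

lemma remainder_range: "0 \<le> remainder l j" "remainder l j \<le> 1"
  using remainder_Suc_range[of l "j - 1"] by (cases j; simp)+

lemma digit_floor: "digit l j = \<lfloor>\<beta> (l + j) * remainder l j\<rfloor>"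
  using remainder_Suc[of l j] remainder_Suc_range[of l j] by linarith

lemma digit_nonneg: "l \<ge> 1 \<Longrightarrow> digit l j \<ge> 0"
  using beta_gt1[of "l + j"] remainder_range[of l j] by (simp add: digit_floor)

lemma first_digit_ge_1: "l \<ge> 1 \<Longrightarrow> digit l 0 \<ge> 1"
  using beta_gt1[of l] by (simp add: digit_floor le_floor_iff)

lemma remainder_periodic: "l \<ge> 1 \<Longrightarrow> remainder (l + p) j = remainder l j"
proof (induction j)
  case (Suc j)
  have "\<beta> (l + p + j) = \<beta> (l + j)"
    using beta_periodic[of "l + j"] Suc.prems by (simp add: add.assoc add.commute[of j])
  then show ?case
    using Suc remainder_Suc[of l j] remainder_Suc[of "l + p" j] digit_floor[of l j] digit_floor[of "l + p" j] by simp
qed simp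

lemma digit_periodic: "l \<ge> 1 \<Longrightarrow> digit (l + p) j = digit l j"
  using beta_periodic[of "l + j"] remainder_periodic[of l j]
  by (simp add: digit_floor add.assoc add.commute[of j])

lemma digit_periodic_mult: "l \<ge> 1 \<Longrightarrow> digit (l + p * n) j = digit l j"
proof (induction n)
  case (Suc n)
  then show ?case using digit_periodic[of "l + p * n" j] by (simp add: algebra_simps)
qed simp

lemma digit_mod_period:
  assumes "l \<ge> 1"
  shows "digit (Suc ((l - 1) mod p)) j = digit l j"
proof -
  have "digit (Suc (m + p)) j = digit (Suc m) j" for m
    using digit_periodic[of "Suc m" j] by simp
  then have "digit (Suc ((l - 1) mod p)) j = digit (Suc (l - 1)) j"
    by (rule periodic_mod[of "\<lambda>m. digit (Suc m) j"])
  then show ?thesis using assms by simp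
qed

text \<open>
  Here \<open>unit (l - 1)\<close> plays the role of 1, since the expansion starts right after position \<open>l - 1\<close>.
\<close>
lemma partial_expansion_of_one:
  assumes "l \<ge> 1"
  shows "(\<Sum>j<n. of_int (digit l j) * unit (l + j)) = unit (l - 1) - remainder l n * unit (l + n - 1)"
proof (induction n)
  case (Suc n)
  have "unit (l + n - 1) = \<beta> (l + n) * unit (l + n)"
    using unit_rec[of "l + n - 1"] assms by simp
  then have "remainder l n * unit (l + n - 1) = (of_int (digit l n) + remainder l (Suc n)) * unit (l + n)"
    by (simp add: remainder_Suc[symmetric])
  then show ?case using Suc by (simp add: algebra_simps)
qed simp

text \<open>
  Digits determine the remainder: the difference of two remainders with the same digits is
  multiplied by the base in every step, and it stays bounded.
\<close>
lemma remainder_eqI: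
  assumes "l + m = l' + m'" "l \<ge> 1" and digits: "\<And>j. digit l (m + j) = digit l' (m' + j)"
  shows "remainder l m = remainder l' m'"
proof -
  obtain b where b: "b > 1" "\<forall>n\<ge>1. b \<le> \<beta> n" using beta_bounded_away by blast
  let ?y = "\<lambda>j. remainder l (m + j) - remainder l' (m' + j)"
  have pos: "l + (m + j) = l' + (m' + j)" for j using assms(1) by simp
  have "?y 0 = 0"
  proof (rule bounded_expanding_orbit_zero[where g = "\<lambda>j. \<beta> (l + (m + j))" and C = 1])
    show "?y (Suc j) = \<beta> (l + (m + j)) * ?y j" for j
      using remainder_Suc[of l "m + j"] remainder_Suc[of l' "m' + j"] digits[of j]
      by (simp add: pos right_diff_distrib)
    show "\<bar>?y j\<bar> \<le> 1" for j
      using remainder_range[of l "m + j"] remainder_range[of l' "m' + j"] by linarith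
  qed (use b assms(2) in auto)
  then show ?thesis by simp
qed

lemma remainder_eq_0I:
  assumes "l \<ge> 1" and digits: "\<And>j. digit l (m + j) = 0"
  shows "remainder l m = 0"
proof -
  obtain b where b: "b > 1" "\<forall>n\<ge>1. b \<le> \<beta> n" using beta_bounded_away by blast
  have "remainder l (m + 0) = 0"
  proof (rule bounded_expanding_orbit_zero[where g = "\<lambda>j. \<beta> (l + (m + j))" and C = 1])
    show "remainder l (m + Suc j) = \<beta> (l + (m + j)) * remainder l (m + j)" for j
      using remainder_Suc[of l "m + j"] digits[of j] by simp
    show "\<bar>remainder l (m + j)\<bar> \<le> 1" for j using remainder_range[of l "m + j"] by simp
  qed (use b assms(1) in auto)
  then show ?thesis by simp
qed

section \<open>Normal strings and greedy expansions\<close>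

lemma below_rec: "value (below M n) = real (count M (Suc n)) * unit (Suc n) + value (below M (Suc n))"
proof -
  have "below M n = replicate_mset (count M (Suc n)) (Suc n) + below M (Suc n)"
    by (rule multiset_eqI) (auto dest: Suc_lessI)
  then show ?thesis by simp
qed

lemma below_eq_self: "\<forall>i\<in>#M. i > n \<Longrightarrow> below M n = M"
  by (intro multiset_eqI) (auto simp: count_eq_zero_iff)

text \<open>
  For a normal string, the greedy algorithm reads off the digits: its \<open>n\<close>-th remainder is the value
  of the rest of the string, rescaled.
\<close>
lemma normal_greedy_remainder:
  assumes "normal M" "0 \<notin># M"
  shows "greedy_remainder \<beta> (value M) n * unit n = value (below M n)"
proof (induction n)
  case 0
  have "below M 0 = M" using assms(2) by (intro below_eq_self) (auto intro: gr0I)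
  then show ?case by simp
next
  case (Suc n)
  let ?r = "greedy_remainder \<beta> (value M) n"
  have u: "unit (Suc n) > 0" by (rule unit_pos)
  have "\<beta> (Suc n) * ?r * unit (Suc n) = real (count M (Suc n)) * unit (Suc n) + value (below M (Suc n))"
    using Suc below_rec[where M = M and n = n] unit_rec[of n] by (simp add: mult.commute mult.left_commute)
  then have r: "\<beta> (Suc n) * ?r = real (count M (Suc n)) + value (below M (Suc n)) / unit (Suc n)"
    using u by (simp add: field_simps)
  have "value (below M (Suc n)) / unit (Suc n) < 1"
    using assms(1) u unfolding normal_def by simp
  moreover have "value (below M (Suc n)) / unit (Suc n) \<ge> 0"
    using value_nonneg u by simp
  ultimately have "\<lfloor>\<beta> (Suc n) * ?r\<rfloor> = int (count M (Suc n))"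
    unfolding r by linarith
  then have "greedy_remainder \<beta> (value M) (Suc n) = value (below M (Suc n)) / unit (Suc n)"
    using r by simp
  then show ?case using u by (simp del: greedy_remainder.simps)
qed

lemma normal_value_in_Fin:
  assumes "normal M" "value M < 1"
  shows "value M \<in> Fin \<beta>"
proof -
  have 0: "0 \<notin># M"
  proof
    assume "0 \<in># M"
    then have "value {#0#} \<le> value M"
      by (intro msum_mono) (auto simp: less_imp_le[OF unit_pos])
    then show False using assms(2) by simp
  qed
  have "greedy_expansion \<beta> (value M) (Suc n) = int (count M (Suc n))" for n
  proof -
    let ?r = "greedy_remainder \<beta> (value M)"
    have u: "unit (Suc n) > 0" by (rule unit_pos)
    have "?r n * unit n = real (count M (Suc n)) * unit (Suc n) + ?r (Suc n) * unit (Suc n)"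
      unfolding normal_greedy_remainder[OF assms(1) 0] by (rule below_rec)
    then have "(\<beta> (Suc n) * ?r n) * unit (Suc n) = (real (count M (Suc n)) + ?r (Suc n)) * unit (Suc n)"
      unfolding unit_rec[of n] distrib_right by (simp only: mult.assoc mult.left_commute)
    then have "\<beta> (Suc n) * ?r n = real (count M (Suc n)) + ?r (Suc n)"
      using u by (metis less_irrefl mult_cancel_right)
    then show ?thesis by (simp add: greedy_expansion_def)
  qed
  then have d: "greedy_expansion \<beta> (value M) n = int (count M n)" if "n \<ge> 1" for n
    using that by (cases n) auto
  have "{n. n \<ge> 1 \<and> greedy_expansion \<beta> (value M) n \<noteq> 0} \<subseteq> set_mset M"
    using d by (auto simp: not_in_iff)
  then have "finite {n. n \<ge> 1 \<and> greedy_expansion \<beta> (value M) n \<noteq> 0}"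
    using finite_subset by blast
  then show ?thesis
    using d assms(2) value_nonneg[of M] by (auto simp: Fin_def finite_sequences_def)
qed

text \<open>
  Once the digits have stopped, the remainder only grows; being less than 1, it must be 0.
\<close>
lemma Fin_imp_value:
  assumes "x \<in> Fin \<beta>"
  shows "\<exists>M. value M = x"
proof -
  let ?a = "greedy_expansion \<beta> x" and ?r = "greedy_remainder \<beta> x"
  have x: "0 \<le> x" "x < 1" and nonneg: "\<And>n. n \<ge> 1 \<Longrightarrow> ?a n \<ge> 0"
    and fin: "finite {n. n \<ge> 1 \<and> ?a n \<noteq> 0}"
    using assms by (auto simp: Fin_def finite_sequences_def)
  obtain N where N: "\<And>n. n \<ge> 1 \<Longrightarrow> ?a n \<noteq> 0 \<Longrightarrow> n \<le> N"
    using fin by (auto simp: finite_nat_set_iff_bounded_le)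
  have rec: "\<beta> (Suc n) * ?r n = of_int (?a (Suc n)) + ?r (Suc n)" for n
    by (simp add: greedy_expansion_def)
  have range: "0 \<le> ?r n \<and> ?r n < 1" for n
    using x frac_ge_0 frac_lt_1 by (cases n) (simp_all add: frac_def[symmetric])
  obtain b where b: "b > 1" "\<forall>n\<ge>1. b \<le> \<beta> n" using beta_bounded_away by blast
  have "?r (N + 0) = 0"
  proof (rule bounded_expanding_orbit_zero[where g = "\<lambda>j. \<beta> (Suc (N + j))" and C = 1])
    show "?r (N + Suc j) = \<beta> (Suc (N + j)) * ?r (N + j)" for j
      using rec[of "N + j"] N[of "Suc (N + j)"] by fastforce
    show "\<bar>?r (N + j)\<bar> \<le> 1" for j using range[of "N + j"] by simp
  qed (use b in auto)
  moreover have "(\<Sum>j<n. of_int (?a (Suc j)) * unit (1 + j)) = x - ?r n * unit n" for n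
  proof (induction n)
    case (Suc n)
    have "?r n * unit n = (of_int (?a (Suc n)) + ?r (Suc n)) * unit (Suc n)"
      unfolding rec[symmetric] unit_rec[of n] by simp
    then show ?case using Suc by (simp add: algebra_simps)
  qed simp
  ultimately have "value (digit_block 1 (\<lambda>j. ?a (Suc j)) N) = x"
    using nonneg by (subst msum_digit_block) auto
  then show ?thesis by blast
qed

end

section \<open>Stabilization of the expansions of one\<close>

locale nonincreasing_alternate = alternate +
  assumes digit_mono: "\<And>l j. l \<ge> 1 \<Longrightarrow> digit (Suc l) j \<ge> digit l (Suc j)"
begin

text \<open>
  The sum \<open>G j\<close> of the digits with index \<open>j\<close> over one period of starting positions is nonincreasing
  in \<open>j\<close>: passing from \<open>j\<close> to \<open>j + 1\<close> at unchanged positions merely permutes the starting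
  positions.  Where \<open>G\<close> has become constant, all the inequalities between digits are equalities.
\<close>
lemma digits_stabilize:
  "\<exists>J c. (\<forall>m. c (m + p) = c m) \<and> (\<forall>l\<ge>1. \<forall>j\<ge>J. digit l j = c (l + j))"
proof -
  define G where "G j = nat (\<Sum>l<p. digit (Suc l) j)" for j
  have sum_shift: "(\<Sum>l<p. digit (Suc (Suc l)) j) = (\<Sum>l<p. digit (Suc l) j)" for j
  proof -
    have "(\<Sum>l<Suc p. digit (Suc l) j) = digit 1 j + (\<Sum>l<p. digit (Suc (Suc l)) j)"
      by (subst sum.lessThan_Suc_shift) simp
    moreover have "digit (Suc p) j = digit 1 j" using digit_periodic[of 1 j] by simp
    ultimately show ?thesis by simp
  qed
  have G: "int (G j) = (\<Sum>l<p. digit (Suc l) j)" for j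
    unfolding G_def using digit_nonneg by (simp add: sum_nonneg)
  obtain J where J: "\<forall>j. G J \<le> G j"
    using ex_has_least_nat[of "\<lambda>_. True" 0 G] by auto
  have G_decreasing: "G (Suc j) \<le> G j" for j
  proof -
    have "int (G (Suc j)) \<le> (\<Sum>l<p. digit (Suc (Suc l)) j)"
      unfolding G using digit_mono by (intro sum_mono) simp
    then show ?thesis using G[of j] sum_shift[of j] by simp
  qed
  have G_const: "G j = G J" if "j \<ge> J" for j
    using that J lift_Suc_antimono_le[of G J j] G_decreasing by (simp add: le_antisym)
  have step_Suc: "digit (Suc (Suc l)) j = digit (Suc l) (Suc j)" if "j \<ge> J" "l < p" for l j
  proof (rule ccontr)
    assume "digit (Suc (Suc l)) j \<noteq> digit (Suc l) (Suc j)"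
    then have "digit (Suc l) (Suc j) < digit (Suc (Suc l)) j"
      using digit_mono[of "Suc l" j] by simp
    then have "int (G (Suc j)) < (\<Sum>l<p. digit (Suc (Suc l)) j)"
      unfolding G using digit_mono that by (intro sum_strict_mono_ex1) auto
    then have "G (Suc j) < G j" using G[of j] sum_shift[of j] by simp
    then show False using G_const[of j] G_const[of "Suc j"] that by simp
  qed
  have step: "digit (Suc l) j = digit l (Suc j)" if "j \<ge> J" "l \<ge> 1" for l j
  proof -
    have mod_one: "digit (Suc (m mod p)) i = digit (Suc m) i" for m i
      by (rule periodic_mod[of "\<lambda>m. digit (Suc m) i"]) (simp add: digit_periodic flip: add_Suc)
    have mod_two: "digit (Suc (Suc (m mod p))) i = digit (Suc (Suc m)) i" for m i
      by (rule periodic_mod[of "\<lambda>m. digit (Suc (Suc m)) i"]) (simp add: digit_periodic flip: add_Suc)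
    show ?thesis
      using step_Suc[of j "(l - 1) mod p"] that p_pos by (simp add: mod_one mod_two)
  qed
  have move: "digit (l + n) j = digit l (j + n)" if "j \<ge> J" "l \<ge> 1" for l j n
    using \<open>j \<ge> J\<close>
  proof (induction n arbitrary: j)
    case (Suc n)
    then show ?case using step[of j "l + n"] Suc.IH[of "Suc j"] that by simp
  qed simp
  \<comment> \<open>the digit of index \<open>p * J \<ge> J\<close> that stands at a position congruent to \<open>m\<close>; adding \<open>p\<close> avoids the start 0\<close>
  define c where "c m = digit (m + p) (p * J)" for m
  have "c (m + p) = c m" for m
    unfolding c_def using p_pos by (intro digit_periodic) simp
  moreover have "digit l j = c (l + j)" if "l \<ge> 1" "j \<ge> J" for l j
  proof -
    have "digit l j = digit (l + p * Suc J) j" using that by (simp only: digit_periodic_mult)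
    also have "\<dots> = digit l (j + p * Suc J)" by (rule move) (use that in auto)
    also have "j + p * Suc J = p * J + (j + p)" by simp
    also have "digit l \<dots> = digit (l + (j + p)) (p * J)"
      by (rule move[symmetric]) (use that p_pos in auto)
    finally show ?thesis by (simp add: c_def add.assoc)
  qed
  ultimately show ?thesis by blast
qed

lemma parry: "parry_alternate_base p \<beta>"
proof -
  obtain J c where c: "\<forall>m. c (m + p) = c m" "\<forall>l\<ge>1. \<forall>j\<ge>J. digit l j = c (l + j)"
    using digits_stabilize by blast
  have "expansion_of_one \<beta> l (n + p) = expansion_of_one \<beta> l n" if "l \<ge> 1" "n \<ge> Suc J" for l n
  proof -
    define j where "j = n - 1"
    then have j: "n = Suc j" "j \<ge> J" using that by simp_all
    have "digit l (j + p) = digit l j"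
      using c that j by (simp add: add.assoc[symmetric])
    then show ?thesis by (simp add: digit_def j)
  qed
  then show ?thesis
    unfolding parry_alternate_base_def eventually_periodic_def
    using alternate p_pos by (metis atLeastAtMost_iff le_add1 plus_1_eq_Suc)
qed

section \<open>Balancing weights\<close>

text \<open>
  The sum is the weight of the expansion of 1 that starts at position \<open>l + 1\<close>, after removal of its
  periodic tail.  It must exceed the weight of the unit at position \<open>l\<close> by the same amount \<open>K\<close> for
  all \<open>l\<close>.  Taking differences in \<open>l\<close>, this becomes the balance equation of the chain whose jumps
  are one step forward, at rate 1, and \<open>j + 1\<close> steps back to \<open>l\<close>, at rate \<open>e j l\<close>.
\<close>
lemma balancing_weights_exist:
  assumes c: "\<And>m. c (m + p) = c m" "\<And>l j. l \<ge> 1 \<Longrightarrow> j \<ge> J \<Longrightarrow> digit l j = c (l + j)"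
  shows "\<exists>(w :: nat \<Rightarrow> real) K. (\<forall>m. w m > 0 \<and> w (m + p) = w m) \<and>
    (\<forall>l. (\<Sum>j<J. of_int (digit (Suc l) j - c (Suc l + j)) * w (Suc l + j)) = w l + K)"
proof -
  define e where "e j l = real_of_int (digit (Suc l) j - digit l (Suc j))" for j l
  \<comment> \<open>kind 0 is the step forward, seen as \<open>p - 1\<close> steps back; the shift by \<open>p\<close> makes \<open>r\<close> periodic from 0 on\<close>
  define r where "r \<kappa> l = (case \<kappa> of 0 \<Rightarrow> 1 | Suc j \<Rightarrow> e j (l + p))" for \<kappa> l
  define s where "s \<kappa> = (case \<kappa> of 0 \<Rightarrow> p - 1 | Suc j \<Rightarrow> Suc j)" for \<kappa>
  have e_periodic: "e j (l + p) = e j l" if "l \<ge> 1" for j l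
    using that digit_periodic[of l] digit_periodic[of "Suc l"] by (simp add: e_def)
  have e_nonneg: "e j l \<ge> 0" if "l \<ge> 1" for j l
    using digit_mono[OF that] by (simp add: e_def)
  have r_nonneg: "r \<kappa> l \<ge> 0" for \<kappa> l
    using e_nonneg p_pos by (simp add: r_def split: nat.split)
  have r_periodic: "r \<kappa> (l + p) = r \<kappa> l" for \<kappa> l
    using e_periodic[of "l + p"] p_pos by (simp add: r_def split: nat.split)
  obtain w where w0: "\<forall>l. w l \<ge> 0 \<and> w (l + p) = w l" and w1: "\<exists>l. w l > 0"
    and bal: "\<forall>l. (\<Sum>\<kappa>\<in>{..J}. r \<kappa> l * w (l + s \<kappa>)) = w l * (\<Sum>\<kappa>\<in>{..J}. r \<kappa> (l + (p - 1) * s \<kappa>))"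
    using cyclic_stationary_vector_exists[of p "{..J}" r s] p_pos r_nonneg r_periodic
    by (simp del: sum.atMost_Suc) blast
  \<comment> \<open>the rates of the backward jumps out of \<open>l\<close> are differences of successive digits at position \<open>l\<close>\<close>
  have outflow: "(\<Sum>j<J. e j (l + (p - 1) * Suc j)) = of_int (digit l 0 - c l)" if "l \<ge> 1" for l
  proof -
    define f where "f j = real_of_int (digit (l + (p - 1) * j) j)" for j
    have "e j (l + (p - 1) * Suc j) = f j - f (Suc j)" for j
    proof -
      have "Suc (l + (p - 1) * Suc j) = (l + (p - 1) * j) + p" using p_pos by simp
      then have "digit (Suc (l + (p - 1) * Suc j)) j = digit (l + (p - 1) * j) j"
        by (simp only: digit_periodic[OF trans_le_add1[OF that]])
      then show ?thesis by (simp only: e_def f_def of_int_diff)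
    qed
    then have "(\<Sum>j<J. e j (l + (p - 1) * Suc j)) = f 0 - f J"
      by (simp add: sum_lessThan_telescope')
    moreover have "f J = of_int (c l)"
    proof -
      have "l + (p - 1) * J + J = l + p * J" using p_pos by (cases p) auto
      then have "f J = of_int (c (l + p * J))"
        unfolding f_def by (simp only: c(2)[OF trans_le_add1[OF that] order_refl])
      also have "c (l + p * J) = c l"
        using periodic_mod[of c p, OF c(1)] by (metis mod_mult_self2)
      finally show ?thesis .
    qed
    ultimately show ?thesis by (simp add: f_def)
  qed
  have balance: "w l + (\<Sum>j<J. e j (Suc l) * w (Suc l + Suc j)) = w (Suc l) * (1 + of_int (digit (Suc l) 0 - c (Suc l)))" for l
  proof -
    have "(\<Sum>\<kappa>\<in>{..J}. r \<kappa> (Suc l) * w (Suc l + s \<kappa>)) = w (l + p) + (\<Sum>j<J. e j (Suc l) * w (Suc l + Suc j))"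
      using e_periodic[of "Suc l"] p_pos
      by (simp add: r_def s_def sum.atMost_shift)
    moreover have "(\<Sum>\<kappa>\<in>{..J}. r \<kappa> (Suc l + (p - 1) * s \<kappa>)) = 1 + (\<Sum>j<J. e j (Suc l + (p - 1) * Suc j))"
    proof -
      have "e j (Suc (l + x + p)) = e j (Suc (l + x))" for j x
        using e_periodic[of "Suc (l + x)" j] by simp
      then show ?thesis by (simp add: r_def s_def sum.atMost_shift del: mult_Suc_right)
    qed
    ultimately show ?thesis
      using bal[rule_format, of "Suc l"] w0 outflow[of "Suc l"] by (simp del: mult_Suc_right)
  qed
  \<comment> \<open>a state that is fed at rate 1 by a state of positive mass has positive mass\<close>
  have w_Suc: "w (Suc l) > 0" if "w l > 0" for l
  proof -
    have "(\<Sum>j<J. e j (Suc l) * w (Suc l + Suc j)) \<ge> 0"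
      using e_nonneg w0 by (intro sum_nonneg) simp
    then have "w (Suc l) \<noteq> 0" using balance[of l] that by auto
    then show ?thesis using w0 by (simp add: less_le)
  qed
  have w_pos: "w m > 0" for m
  proof -
    obtain l0 where l0: "w l0 > 0" using w1 by blast
    have later: "w (l0 + n) > 0" for n by (induction n) (use l0 w_Suc in auto)
    have "w (m + p * l0) = w m"
      using periodic_mod[of w p] w0 by (metis mod_mult_self2)
    moreover have "p * l0 \<ge> l0" using mult_le_mono1[OF p_pos, of l0] by simp
    then obtain x where "m + p * l0 = l0 + x" using le_Suc_ex trans_le_add2 by blast
    ultimately show ?thesis using later[of x] by simp
  qed
  \<comment> \<open>the excess \<open>S (Suc l) - w l\<close> is constant by the balance equation\<close>
  define S where "S l = (\<Sum>j<J. of_int (digit l j - c (l + j)) * w (l + j))" for l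
  have "S (Suc (Suc l)) - w (Suc l) = S (Suc l) - w l" for l
  proof -
    let ?t = "\<lambda>j. real_of_int (digit (Suc l) j - c (Suc l + j)) * w (Suc l + j)"
    have "S (Suc l) = (\<Sum>j<Suc J. ?t j)" using c(2)[of "Suc l" J] by (simp add: S_def)
    also have "\<dots> = ?t 0 + (\<Sum>j<J. ?t (Suc j))" by (rule sum.lessThan_Suc_shift)
    finally have now: "S (Suc l) = ?t 0 + (\<Sum>j<J. ?t (Suc j))" .
    have "S (Suc (Suc l)) = (\<Sum>j<J. e j (Suc l) * w (Suc l + Suc j) + ?t (Suc j))"
      unfolding S_def by (intro sum.cong) (simp_all add: e_def algebra_simps)
    then have "S (Suc (Suc l)) - S (Suc l) = (\<Sum>j<J. e j (Suc l) * w (Suc l + Suc j)) - ?t 0"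
      unfolding now sum.distrib by simp
    then show ?thesis using balance[of l] by (simp add: algebra_simps)
  qed
  then have "S (Suc l) - w l = S (Suc 0) - w 0" for l
    by (induction l) simp_all
  then have "S (Suc l) = w l + (S (Suc 0) - w 0)" for l by (metis add.commute diff_add_cancel)
  then show ?thesis using w_pos w0 unfolding S_def by blast
qed

end

section \<open>Carrying without increasing the weight\<close>

text \<open>
  The stabilization index, the limit digits and the weights are fixed here, so that the carrying
  step can be stated in terms of them.
\<close>
locale weighted_alternate = nonincreasing_alternate +
  fixes J :: nat and c :: "nat \<Rightarrow> int" and w :: "nat \<Rightarrow> real" and K :: real
  assumes limit_periodic: "c (m + p) = c m"
    and digit_limit: "l \<ge> 1 \<Longrightarrow> j \<ge> J \<Longrightarrow> digit l j = c (l + j)"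
    and weight_pos: "w m > 0"
    and weight_periodic: "w (m + p) = w m"
    and weight_balance: "(\<Sum>j<J. of_int (digit (Suc l) j - c (Suc l + j)) * w (Suc l + j)) = w l + K"
begin

abbreviation "weight \<equiv> msum w"

lemma limit_nonneg: "c m \<ge> 0"
proof -
  have "c m = c (m + p * Suc J)"
    using periodic_mod[of c p, OF limit_periodic] by (metis mod_mult_self2)
  moreover have "m + p * Suc J \<ge> Suc J"
    using mult_le_mono1[OF p_pos, of "Suc J"] by (simp add: trans_le_add2)
  then obtain i where "m + p * Suc J = Suc i + J"
    by (metis add.commute add_Suc_right le_Suc_ex)
  ultimately have "c m = digit (Suc i) J" by (simp add: digit_limit)
  then show ?thesis using digit_nonneg by simp
qed

text \<open>
  When the expansions of 1 are finite, each of them weighs at least as much as its first digit,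
  which is at least 1.  Hence \<open>K \<ge> w (l + 1) - w l\<close>, and these differences sum to 0 over one period.
\<close>
lemma K_nonneg_if_finite:
  assumes "\<And>m. c m = 0"
  shows "K \<ge> 0"
proof -
  have "K \<ge> w (Suc l) - w l" for l
  proof -
    have "w (Suc l) \<le> of_int (digit (Suc l) 0) * w (Suc l)"
      using first_digit_ge_1[of "Suc l"] weight_pos[of "Suc l"] by simp
    also have "\<dots> \<le> (\<Sum>j<Suc J. of_int (digit (Suc l) j) * w (Suc l + j))"
      using digit_nonneg weight_pos
      by (subst sum.lessThan_Suc_shift) (auto intro!: sum_nonneg mult_nonneg_nonneg simp: less_imp_le)
    also have "\<dots> = w l + K"
      using weight_balance[of l] digit_limit[of "Suc l" J] assms by simp
    finally show ?thesis by simp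
  qed
  then have "(\<Sum>l<p. w (Suc l) - w l) \<le> (\<Sum>l<p. K)" by (intro sum_mono) auto
  moreover have "(\<Sum>l<p. w (Suc l) - w l) = 0"
    using weight_periodic[of 0] by (simp add: sum_lessThan_telescope)
  ultimately show ?thesis using p_pos by (simp add: zero_le_mult_iff)
qed

text \<open>
  The smallest string that follows the expansion of 1 for \<open>n\<close> digits and then exceeds it by 1,
  and the string that replaces it.
\<close>
definition overflow :: "nat \<Rightarrow> nat \<Rightarrow> nat multiset" where
  "overflow l n = add_mset (l + n) (digit_block l (digit l) (Suc n))"

definition carried :: "nat \<Rightarrow> nat \<Rightarrow> nat multiset" where
  "carried l n = add_mset (l - 1)
     (digit_block (l + Suc n) (\<lambda>j. digit (l + Suc n) j - digit l (Suc n + j)) J)"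

lemma digit_mono_iterated: "l \<ge> 1 \<Longrightarrow> digit l (n + j) \<le> digit (l + n) j"
proof (induction n arbitrary: j)
  case (Suc n)
  have "digit l (Suc n + j) \<le> digit (l + n) (Suc j)" using Suc.IH[of "Suc j"] Suc.prems by simp
  also have "\<dots> \<le> digit (l + Suc n) j" using digit_mono[of "l + n" j] Suc.prems by simp
  finally show ?case .
qed simp

lemma msum_carried:
  assumes "l \<ge> 1"
  shows "msum f (carried l n) = f (l - 1)
    + (\<Sum>j<J. of_int (digit (l + Suc n) j) * f (l + Suc n + j))
    - (\<Sum>j<J. of_int (digit l (Suc n + j)) * f (l + Suc n + j))"
  using digit_mono_iterated[OF assms, of "Suc n"]
  by (simp add: carried_def msum_digit_block sum_subtractf[symmetric] left_diff_distrib del: add_Suc_right)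

lemma msum_overflow:
  assumes "l \<ge> 1"
  shows "msum f (overflow l n) = f (l + n) + (\<Sum>j<Suc n. of_int (digit l j) * f (l + j))"
  using digit_nonneg[OF assms] by (simp add: overflow_def msum_digit_block del: digit_block.simps(2) sum.lessThan_Suc)

text \<open>
  The spare unit of the overflow is expanded from position \<open>l + n + 1\<close> on.  From index \<open>J\<close> on, its
  digits agree with those of the expansion that starts at \<open>l\<close>, so the two remainders cancel.
\<close>
lemma value_carried:
  assumes "l \<ge> 1"
  shows "value (carried l n) = value (overflow l n)"
proof -
  have "remainder (l + Suc n) J = remainder l (Suc n + J)"
    using assms by (intro remainder_eqI) (simp_all add: digit_limit add.assoc)
  moreover have "(\<Sum>j<J. of_int (digit l (Suc n + j)) * unit (l + Suc n + j))
    = (\<Sum>j<Suc n + J. of_int (digit l j) * unit (l + j)) - (\<Sum>j<Suc n. of_int (digit l j) * unit (l + j))"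
    by (simp only: sum_split_tail[of "\<lambda>m j. of_int (digit l j) * unit m"])
  ultimately show ?thesis
    using partial_expansion_of_one[of "l + Suc n" J] partial_expansion_of_one[of l "Suc n + J"]
      partial_expansion_of_one[of l "Suc n"] assms
    by (simp add: msum_carried msum_overflow add.assoc del: sum.lessThan_Suc)
qed

text \<open>
  Comparing the balance equations of the expansions that start at \<open>l\<close> and at \<open>l + n + 1\<close>, the
  constant \<open>K\<close> cancels, and the weight drops exactly by that of the limit digits at
  \<open>l, ..., l + n\<close>.
\<close>
lemma weight_carried:
  assumes "l \<ge> 1"
  shows "weight (carried l n) \<le> weight (overflow l n)"
proof -
  let ?S = "\<lambda>l n. \<Sum>j<n. of_int (digit l j - c (l + j)) * w (l + j)"
  have S: "?S l J = w (l - 1) + K" if "l \<ge> 1" for l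
    using weight_balance[of "l - 1"] that by simp
  have "?S l (J + i) = ?S l J" for i
    using digit_limit[OF assms] by (induction i) simp_all
  then have "w (l - 1) + K = ?S l (Suc n + J)"
    using S[OF assms] by (simp only: add.commute[of "Suc n" J])
  also have "\<dots> = ?S l (Suc n) + (\<Sum>j<J. of_int (digit l (Suc n + j) - c (l + Suc n + j)) * w (l + Suc n + j))"
    by (rule sum_split_tail[of "\<lambda>m j. of_int (digit l j - c m) * w m"])
  also have "\<dots> = ?S l (Suc n) + ?S (l + Suc n) J
      - ((\<Sum>j<J. of_int (digit (l + Suc n) j) * w (l + Suc n + j))
         - (\<Sum>j<J. of_int (digit l (Suc n + j)) * w (l + Suc n + j)))"
    by (simp only: left_diff_distrib of_int_diff sum_subtractf)
  also have "?S (l + Suc n) J = w (l + n) + K" using S[of "l + Suc n"] by simp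
  also have "?S l (Suc n) = (\<Sum>j<Suc n. of_int (digit l j) * w (l + j)) - (\<Sum>j<Suc n. of_int (c (l + j)) * w (l + j))"
    by (simp add: sum_subtractf[symmetric] algebra_simps del: sum.lessThan_Suc)
  finally have "weight (carried l n) = weight (overflow l n) - (\<Sum>j<Suc n. of_int (c (l + j)) * w (l + j))"
    using assms by (simp add: msum_carried msum_overflow del: sum.lessThan_Suc)
  moreover have "(\<Sum>j<Suc n. of_int (c (l + j)) * w (l + j)) \<ge> 0"
    using limit_nonneg weight_pos by (intro sum_nonneg mult_nonneg_nonneg) (auto simp: less_imp_le)
  ultimately show ?thesis by simp
qed

text \<open>
  A string that is normal except at its top contains an overflow there.  As long as its digits
  agree with the expansion of 1, its tail is worth at least the remainder of 1.  At the first
  disagreement the digit must therefore be too large by at least 1, because the rest of the string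
  is worth less than a unit.  If there is no disagreement, the string is itself a finite expansion
  of 1, and it is replaced by a single unit.
\<close>
lemma carry:
  assumes l: "l \<ge> 1" and support: "\<forall>i\<in>#N. i \<ge> l"
    and tails: "\<forall>n\<ge>l. value (below N n) < unit n" and large: "value N \<ge> unit (l - 1)"
  shows "\<exists>N'. l - 1 \<in># N' \<and> value N' = value N \<and> weight N' \<le> weight N"
proof -
  let ?T = "\<lambda>j. value (below N (l + j - 1))"
  have T0: "?T 0 = value N"
  proof -
    have "below N (l - 1) = N" using support l by (intro below_eq_self) force
    then show ?thesis by simp
  qed
  have T_Suc: "?T j = real (count N (l + j)) * unit (l + j) + ?T (Suc j)" for j
    using below_rec[where M = N and n = "l + j - 1"] l by simp
  have tail_ge: "?T n \<ge> remainder l n * unit (l + n - 1)"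
    if "\<And>j. j < n \<Longrightarrow> int (count N (l + j)) = digit l j" for n
  proof -
    have "?T n = value N - (\<Sum>j<n. of_int (digit l j) * unit (l + j))"
      using that
    proof (induction n)
      case (Suc n)
      have "real_of_int (digit l n) = real (count N (l + n))"
        using Suc.prems[of n] by (metis lessI of_int_of_nat_eq)
      then show ?case using Suc T_Suc[of n] by simp
    qed (use T0 in simp)
    then show ?thesis using large by (simp add: partial_expansion_of_one[OF l])
  qed
  show ?thesis
  proof (cases "\<forall>j. int (count N (l + j)) = digit l j")
    case True
    have "finite ((\<lambda>j. l + j) -` set_mset N)" by (intro finite_vimageI) auto
    then obtain m where m: "\<And>j. l + j \<in># N \<Longrightarrow> j < m"
      by (auto simp: finite_nat_set_iff_bounded)
    have vanish: "digit l j = 0" if "j \<ge> m" for j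
      using True m[of j] that by (metis count_inI leD of_nat_0)
    \<comment> \<open>the limit digits occur as digits of arbitrarily large index, where all digits vanish\<close>
    have "c i = 0" for i
    proof -
      have "c i = c (i + p * (l + m + J))"
        using periodic_mod[of c p, OF limit_periodic] by (metis mod_mult_self2)
      moreover have "i + p * (l + m + J) \<ge> l + m + J"
        using mult_le_mono1[OF p_pos, of "l + m + J"] by (simp add: trans_le_add2)
      then obtain x where "i + p * (l + m + J) = l + (m + J + x)"
        by (metis add.assoc le_Suc_ex)
      ultimately have "c i = digit l (m + J + x)" using digit_limit[OF l] by simp
      then show ?thesis using vanish by simp
    qed
    then have K: "K \<ge> 0" and c0: "\<And>i. c i = 0" by (auto intro: K_nonneg_if_finite)
    have "?T m = 0"
    proof -
      have "below N (l + m - 1) = {#}"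
      proof -
        have False if "x \<in># N" "x > l + m - 1" for x
        proof -
          obtain j where "x = l + j" using support \<open>x \<in># N\<close> le_Suc_ex by blast
          then show False using m[of j] that by simp
        qed
        then show ?thesis by (intro multiset_eqI) (simp add: count_eq_zero_iff, blast)
      qed
      then show ?thesis by (simp only: msum_simps)
    qed
    then have "value N = (\<Sum>j<m. of_int (digit l j) * unit (l + j))"
    proof -
      have "value N = (\<Sum>j<n. of_int (digit l j) * unit (l + j)) + ?T n" for n
      proof (induction n)
        case (Suc n)
        have "real_of_int (digit l n) = real (count N (l + n))"
          using True by (metis of_int_of_nat_eq)
        then show ?case using Suc T_Suc[of n] by simp
      qed (use T0 in simp)
      from this[of m] \<open>?T m = 0\<close> show ?thesis by simp
    qed
    also have "\<dots> \<le> unit (l - 1)"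
      using partial_expansion_of_one[OF l, of m] remainder_range[of l m] unit_pos[of "l + m - 1"] by simp
    finally have "value N = unit (l - 1)" using large by simp
    moreover have "w (l - 1) \<le> weight N"
    proof -
      have "w (l - 1) \<le> (\<Sum>j<J. of_int (digit l j) * w (l + j))"
        using weight_balance[of "l - 1"] l K c0 by simp
      also have "\<dots> = weight (digit_block l (digit l) J)"
        using digit_nonneg[OF l] by (simp add: msum_digit_block)
      also have "\<dots> \<le> weight N"
        using True weight_pos by (intro msum_mono digit_block_subset) (auto simp: less_imp_le)
      finally show ?thesis .
    qed
    ultimately show ?thesis by (intro exI[of _ "{#l - 1#}"]) simp
  next
    case False
    define n where "n = (LEAST j. int (count N (l + j)) \<noteq> digit l j)"
    have differ: "int (count N (l + n)) \<noteq> digit l n"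
      unfolding n_def using False by (intro LeastI_ex[of "\<lambda>j. int (count N (l + j)) \<noteq> digit l j"]) auto
    have agree: "int (count N (l + j)) = digit l j" if "j < n" for j
      using not_less_Least[of j "\<lambda>j. int (count N (l + j)) \<noteq> digit l j"] that unfolding n_def by blast
    have "digit l n < int (count N (l + n)) + 1"
    proof -
      have u: "unit (l + n - 1) = \<beta> (l + n) * unit (l + n)"
        using unit_rec[of "l + n - 1"] l by simp
      have "of_int (digit l n) * unit (l + n) \<le> (\<beta> (l + n) * remainder l n) * unit (l + n)"
        using remainder_Suc[of l n] remainder_Suc_range[of l n] unit_pos[of "l + n"]
        by (intro mult_right_mono) auto
      also have "\<dots> = remainder l n * unit (l + n - 1)" unfolding u by simp
      also have "\<dots> \<le> ?T n" using agree by (rule tail_ge)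
      also have "\<dots> < (real (count N (l + n)) + 1) * unit (l + n)"
        using T_Suc[of n] tails[rule_format, of "l + n"] by (simp add: distrib_right)
      finally have "real_of_int (digit l n) < real (count N (l + n)) + 1"
        using unit_pos[of "l + n"] by simp
      then show ?thesis by linarith
    qed
    then have excess: "digit l n + 1 \<le> int (count N (l + n))" using differ by simp
    have "overflow l n \<subseteq># N"
    proof (rule mset_subset_eqI)
      fix i
      show "count (overflow l n) i \<le> count N i"
      proof (cases "l \<le> i \<and> i \<le> l + n")
        case True
        then obtain j where j: "i = l + j" "j \<le> n" by (metis le_Suc_ex nat_add_left_cancel_le)
        show ?thesis
        proof (cases "j = n")
          case True
          then show ?thesis using excess digit_nonneg[OF l, of n]
            by (simp add: overflow_def count_digit_block j nat_le_iff del: digit_block.simps)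
        next
          case False
          then show ?thesis using agree[of j] j
            by (simp add: overflow_def count_digit_block nat_le_iff del: digit_block.simps)
        qed
      next
        case False
        then show ?thesis
          by (auto simp: overflow_def count_digit_block simp del: digit_block.simps)
      qed
    qed
    then have exchange: "msum f (N - overflow l n + carried l n) = msum f N - msum f (overflow l n) + msum f (carried l n)" for f
      by (simp only: msum_simps msum_diff)
    have "l - 1 \<in># N - overflow l n + carried l n" by (simp add: carried_def)
    moreover have "value (N - overflow l n + carried l n) = value N"
      unfolding exchange using value_carried[OF l, of n] by simp
    moreover have "weight (N - overflow l n + carried l n) \<le> weight N"
      unfolding exchange using weight_carried[OF l, of n] by simp
    ultimately show ?thesis by blast
  qed
qed

section \<open>Normal forms\<close>

text \<open>
  Induction on the number of units that the weight allows.  Among all strings of the same value and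
  no larger weight, one is chosen whose first position \<open>q\<close> is as far left as possible.  Without one
  unit at \<open>q\<close> the string is lighter and has a normal form by induction.  Putting the unit back can
  spoil normality only to the left of \<open>q\<close>, hence already at \<open>q - 1\<close> since units decrease; but there a
  carry would contradict the choice of \<open>q\<close>.
\<close>
lemma normal_form_exists_weighted:
  assumes "wmin > 0" "\<And>i. w i \<ge> wmin"
  shows "weight M < real k * wmin \<Longrightarrow>
    \<exists>N. normal N \<and> value N = value M \<and> weight N \<le> weight M"
proof (induction k arbitrary: M)
  case 0
  have "weight M \<ge> 0" using weight_pos by (intro msum_nonneg) (auto simp: less_imp_le)
  then show ?case using 0 by simp
next
  case (Suc k)
  show ?case
  proof (cases "M = {#}")
    case True
    then show ?thesis using unit_pos by (intro exI[of _ "{#}"]) (simp add: normal_def)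
  next
    case False
    let ?reach = "\<lambda>q. \<exists>N. q \<in># N \<and> value N = value M \<and> weight N \<le> weight M"
    define q where "q = (LEAST q. ?reach q)"
    have "\<exists>q. ?reach q" using False by (metis multiset_nonemptyE order_refl)
    then have "?reach q" unfolding q_def by (rule LeastI_ex)
    then obtain N0 where N0: "value (add_mset q N0) = value M" "weight (add_mset q N0) \<le> weight M"
      by (metis multi_member_split)
    have "weight N0 < real k * wmin"
      using N0(2) Suc.prems assms(2)[of q] by (simp add: algebra_simps)
    from Suc.IH[OF this] obtain N1 where N1: "normal N1" "value N1 = value N0" "weight N1 \<le> weight N0"
      by blast
    define N where "N = add_mset q N1"
    have N: "value N = value M" "weight N \<le> weight M" using N0 N1 by (simp_all add: N_def)
    have first: "i \<ge> q" if "?reach i" for i unfolding q_def using that by (rule Least_le)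
    then have support: "\<forall>i\<in>#N. i \<ge> q" using N by blast
    have tails: "value (below N n) < unit n" if "n \<ge> q" for n
      using that N1(1) by (simp add: N_def normal_def)
    have "normal N"
      unfolding normal_def
    proof
      fix n
      show "value (below N n) < unit n"
      proof (cases "n \<ge> q")
        case True
        then show ?thesis by (rule tails)
      next
        case below_q: False
        have "value N < unit (q - 1)"
        proof (rule ccontr)
          assume "\<not> value N < unit (q - 1)"
          then obtain N' where "q - 1 \<in># N'" "value N' = value N" "weight N' \<le> weight N"
            using carry[of q N] support tails below_q by force
          then have "?reach (q - 1)" using N by (intro exI[of _ N']) auto
          then show False using first[of "q - 1"] below_q by simp
        qed
        also have "\<dots> \<le> unit n" using below_q by (intro unit_decreasing) simp
        finally show ?thesis
          using msum_mono[of unit "below N n" N] unit_pos by (simp add: less_imp_le order_le_less_trans)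
      qed
    qed
    then show ?thesis using N by blast
  qed
qed

end

context nonincreasing_alternate
begin

lemma normal_form_exists: "\<exists>N. normal N \<and> value N = value M"
proof -
  obtain J c where c: "\<forall>m. c (m + p) = c m" "\<forall>l\<ge>1. \<forall>j\<ge>J. digit l j = c (l + j)"
    using digits_stabilize by blast
  obtain w and K :: real where w: "\<forall>m. w m > 0 \<and> w (m + p) = w m"
    "\<forall>l. (\<Sum>j<J. of_int (digit (Suc l) j - c (Suc l + j)) * w (Suc l + j)) = w l + K"
    using balancing_weights_exist[of c J] c by blast
  interpret weighted_alternate p \<beta> J c w K
    by unfold_locales (use c w in auto)
  define wmin where "wmin = Min (w ` {..<p})"
  have "wmin > 0" unfolding wmin_def using w(1) p_pos by (subst Min_gr_iff) (auto simp: lessThan_empty_iff)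
  moreover have "w i \<ge> wmin" for i
  proof -
    have "w i = w (i mod p)" using periodic_mod[of w p i] w(1) by simp
    then show ?thesis unfolding wmin_def using p_pos by (intro Min_le) auto
  qed
  moreover obtain k where "weight M < real k * wmin"
    using \<open>wmin > 0\<close> by (metis reals_Archimedean3)
  ultimately show ?thesis using normal_form_exists_weighted by blast
qed

section \<open>Closure under addition and subtraction\<close>

lemma value_in_Fin: "value M < 1 \<Longrightarrow> value M \<in> Fin \<beta>"
  using normal_form_exists[of M] normal_value_in_Fin by metis

lemma property_PF: "property_PF \<beta>"
  unfolding property_PF_def
proof (intro ballI impI)
  fix x y assume "x \<in> Fin \<beta>" "y \<in> Fin \<beta>" and less: "x + y \<in> {0..<1}"
  then obtain M N where "value M = x" "value N = y" using Fin_imp_value by metis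
  then have "value (M + N) = x + y" by simp
  then show "x + y \<in> Fin \<beta>" using value_in_Fin[of "M + N"] less by simp
qed

text \<open>
  Each unit is replaced by a finite expansion of 1, whose leading digit is nonzero; repeating this
  with a unit of the leading digit moves it to the right one position at a time.
\<close>
lemma unit_expansion_through:
  assumes simple: "\<And>l. l \<ge> 1 \<Longrightarrow> \<exists>n. remainder l n = 0" and "i \<le> k"
  shows "\<exists>T. value T = unit i \<and> k \<in># T"
  using \<open>i \<le> k\<close>
proof (induction rule: inc_induct)
  case base
  show ?case by (intro exI[of _ "{#k#}"]) simp
next
  case (step i)
  then obtain T where T: "value T = unit (Suc i)" "k \<in># T" by blast
  obtain n where n: "remainder (Suc i) n = 0" using simple[of "Suc i"] by auto
  let ?D = "digit_block (Suc i) (digit (Suc i)) n"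
  have D: "value ?D = unit i"
    using partial_expansion_of_one[of "Suc i" n] digit_nonneg[of "Suc i"] n
    by (simp add: msum_digit_block)
  have "n > 0" using n by (cases n) auto
  then have "Suc i \<in># ?D"
    using first_digit_ge_1[of "Suc i"] by (simp add: count_digit_block flip: count_greater_zero_iff)
  then have "value (?D - {#Suc i#} + T) = unit i"
    using msum_diff[of "{#Suc i#}" ?D unit] T D by (simp only: msum_simps) simp
  then show ?case using T by (intro exI[of _ "?D - {#Suc i#} + T"]) simp
qed

lemma subtract_value:
  assumes simple: "\<And>l. l \<ge> 1 \<Longrightarrow> \<exists>n. remainder l n = 0" and "value M \<ge> value N"
  shows "\<exists>D. value D = value M - value N"
  using assms(2)
proof (induction N)
  case empty
  show ?case by auto
next
  case (add k N)
  then have "value N \<le> value M" using unit_pos[of k] by simp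
  then obtain D where "value D = value M - value N" using add.IH by blast
  then obtain R where R: "normal R" "value R = value M - value N" using normal_form_exists by metis
  \<comment> \<open>a normal string supported to the right of \<open>k\<close> is worth less than a unit at \<open>k\<close>\<close>
  have "\<exists>i\<in>#R. i \<le> k"
  proof (rule ccontr)
    assume "\<not> (\<exists>i\<in>#R. i \<le> k)"
    then have "below R k = R" by (intro below_eq_self) (auto simp: not_le)
    then show False using R add.prems unfolding normal_def by (metis add_le_imp_le_diff msum_simps(4) not_less)
  qed
  then obtain i where i: "i \<in># R" "i \<le> k" by blast
  obtain T where T: "value T = unit i" "k \<in># T" using unit_expansion_through[OF simple i(2)] by blast
  have "value (R - {#i#} + (T - {#k#})) = value M - value (add_mset k N)"
    using msum_diff[of "{#i#}" R unit] msum_diff[of "{#k#}" T unit] R T i by (simp only: msum_simps) simp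
  then show ?case by blast
qed

lemma property_F:
  assumes "simple_parry_alternate_base p \<beta>"
  shows "property_F \<beta>"
proof -
  have finite_expansion: "\<exists>n. remainder l n = 0" if "l \<ge> 1" for l
  proof -
    have mod: "digit (Suc ((l - 1) mod p)) j = digit l j" for j
      using that by (rule digit_mod_period)
    have "Suc ((l - 1) mod p) \<in> {1..p}" using p_pos by (simp add: Suc_leI)
    then have "finite {n. n \<ge> 1 \<and> expansion_of_one \<beta> (Suc ((l - 1) mod p)) n \<noteq> 0}"
      using assms by (auto simp: simple_parry_alternate_base_def finite_sequences_def)
    then obtain m where m: "\<And>n. n \<ge> 1 \<Longrightarrow> expansion_of_one \<beta> (Suc ((l - 1) mod p)) n \<noteq> 0 \<Longrightarrow> n < m"
      by (auto simp: finite_nat_set_iff_bounded)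
    have "digit (Suc ((l - 1) mod p)) (m + j) = 0" for j
      using m[of "Suc (m + j)"] by (auto simp: digit_def)
    with mod have "remainder l m = 0" using that by (intro remainder_eq_0I) auto
    then show ?thesis by blast
  qed
  show ?thesis
    unfolding property_F_def
  proof (intro ballI conjI impI)
    fix x y assume x: "x \<in> Fin \<beta>" and y: "y \<in> Fin \<beta>"
    { assume "x + y \<in> {0..<1}"
      then show "x + y \<in> Fin \<beta>" using property_PF x y by (simp add: property_PF_def) }
    { assume diff: "x - y \<in> {0..<1}"
      obtain M N where "value M = x" "value N = y" using x y Fin_imp_value by metis
      then obtain D where "value D = x - y"
        using subtract_value[OF finite_expansion, of N M] diff by auto
      then show "x - y \<in> Fin \<beta>" using value_in_Fin[of D] diff by simp }
  qed
qed

end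

theorem theorem3p2:
  fixes p :: nat and \<beta> :: "nat \<Rightarrow> real"
  assumes "alternate_base p \<beta>"
    and "\<forall>l\<in>{1..p}. \<forall>j\<ge>1.
           expansion_of_one \<beta> (cyclic_index p (int l - int j + 1)) j
             \<ge> expansion_of_one \<beta> (cyclic_index p (int l - int j)) (j + 1)"
  shows "parry_alternate_base p \<beta> \<and> property_PF \<beta>
           \<and> (simple_parry_alternate_base p \<beta> \<longrightarrow> property_F \<beta>)"
proof -
  interpret alternate p \<beta> by unfold_locales (rule assms(1))
  have cyclic: "digit (cyclic_index p (int m + int p * k)) j = digit m j" if "m \<ge> 1" for m j k
  proof -
    have "(int m + int p * k - 1) mod int p = int ((m - 1) mod p)"
    proof -
      have "int m + int p * k - 1 = int (m - 1) + k * int p" using that by (simp add: of_nat_diff)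
      then show ?thesis by (simp only: zmod_int mod_mult_self1)
    qed
    then have "cyclic_index p (int m + int p * k) = Suc ((m - 1) mod p)"
      by (simp add: cyclic_index_def)
    moreover have "digit (Suc ((m - 1) mod p)) j = digit m j"
      using that by (rule digit_mod_period)
    ultimately show ?thesis by simp
  qed
  have "digit l (Suc j) \<le> digit (Suc l) j" if "l \<ge> 1" for l j
  proof -
    \<comment> \<open>the representative in \<open>{1..p}\<close> of the position \<open>l + j + 1\<close> shared by the two digits\<close>
    define r where "r = Suc ((l + j) mod p)"
    define k where "k = - int ((l + j) div p)"
    have "int p * int ((l + j) div p) + int ((l + j) mod p) = int (l + j)"
      by (metis mult_div_mod_eq of_nat_add of_nat_mult)
    then have r: "int r - int (Suc j) = int l + int p * k"
      "int r - int (Suc j) + 1 = int (Suc l) + int p * k"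
      by (simp_all add: r_def k_def)
    have "r \<in> {1..p}" unfolding r_def using p_pos by (simp add: Suc_leI)
    then have "expansion_of_one \<beta> (cyclic_index p (int r - int (Suc j))) (Suc j + 1)
        \<le> expansion_of_one \<beta> (cyclic_index p (int r - int (Suc j) + 1)) (Suc j)"
      using assms(2) by (metis le_add1 plus_1_eq_Suc)
    then have "digit (cyclic_index p (int l + int p * k)) (Suc j)
        \<le> digit (cyclic_index p (int (Suc l) + int p * k)) j"
      unfolding r(2) unfolding r(1) digit_def by simp
    then show ?thesis using cyclic that by (metis le_Suc_eq)
  qed
  then interpret nonincreasing_alternate p \<beta> by unfold_locales
  show ?thesis using parry property_PF property_F by blast
qed

end
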